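(* If $n$ is even, then there exists an associative magic-faced hypercube of dimension $n$ which is unique up to the symmetry group $\mathrm{Aut}(Q_n)\cong C_2^n\rtimes S_n$ of the hypercube. If $n$ is odd, then no associative magic-faced hypercube of dimension $n$ exists.
   Context: $Q_n$ is the hypercube graph on vertex set $\{0,1\}^n$ (two vertices adjacent iff they differ in exactly one coordinate); $\mathrm{Aut}(Q_n)$ is its automorphism group, acting on labelings by permuting positions. A magic-faced hypercube of dimension $n$ is an arrangement of the numbers $1,\ldots,2^n$ in a $2\times\cdots\times2$ ($n$-fold) array, each number used once, such that every $2\times2$ face has the same sum; equivalently, a bijective labeling of the vertices of $Q_n$ by $1,\ldots,2^n$ such that the labels on every $4$-cycle of $Q_n$ have the same sum. It is associative if any two numbers at positions symmetrically opposite the center of the hypercube (antipodal positions, i.e. positions differing in all $n$ coordinates) have the same sum (which must then be $2^n+1$).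
   Formalization: The nonexistence claim for odd n is stated for n > 1 only, because for n = 1 there are no 2×2 faces and the labeling 1, 2 is vacuously magic-faced and associative. *)

theory Defs
  imports "HOL-Algebra.Algebra"
begin

section \<open>The hypercube graph\<close>

text \<open>Entries are integers so that the vertex set is also the carrier of
  \<open>product_group {1..n} (\<lambda>_. integer_mod_group 2)\<close>.\<close>

definition cube_verts :: "nat \<Rightarrow> (nat \<Rightarrow> int) set" where
  "cube_verts n = {1..n} \<rightarrow>\<^sub>E {0, 1}"

definition cube_adj :: "nat \<Rightarrow> (nat \<Rightarrow> int) \<Rightarrow> (nat \<Rightarrow> int) \<Rightarrow> bool" where
  "cube_adj n u v \<longleftrightarrow> u \<in> cube_verts n \<and> v \<in> cube_verts n \<and> (\<exists>!i. i \<in> {1..n} \<and> u i \<noteq> v i)"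

definition cube_antipodal :: "nat \<Rightarrow> (nat \<Rightarrow> int) \<Rightarrow> (nat \<Rightarrow> int) \<Rightarrow> bool" where
  "cube_antipodal n u v \<longleftrightarrow>
     u \<in> cube_verts n \<and> v \<in> cube_verts n \<and> (\<forall>i\<in>{1..n}. u i \<noteq> v i)"

definition cube_faces :: "nat \<Rightarrow> (nat \<Rightarrow> int) set set" where
  "cube_faces n =
     {F. \<exists>i\<in>{1..n}. \<exists>j\<in>{1..n}. \<exists>x\<in>cube_verts n. i \<noteq> j \<and>
           F = {y \<in> cube_verts n. \<forall>k\<in>{1..n} - {i, j}. y k = x k}}"

definition cube_aut :: "nat \<Rightarrow> ((nat \<Rightarrow> int) \<Rightarrow> (nat \<Rightarrow> int)) monoid" where
  "cube_aut n = BijGroup (cube_verts n)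
     \<lparr>carrier := {\<phi> \<in> Bij (cube_verts n).
        \<forall>u\<in>cube_verts n. \<forall>v\<in>cube_verts n. cube_adj n (\<phi> u) (\<phi> v) \<longleftrightarrow> cube_adj n u v}\<rparr>"


section \<open>The semidirect product of \<open>C\<^sub>2\<^sup>n\<close> and \<open>S\<^sub>n\<close>\<close>

definition semidirect_product ::
    "('a, 'm) monoid_scheme \<Rightarrow> ('b, 'k) monoid_scheme \<Rightarrow> ('b \<Rightarrow> 'a \<Rightarrow> 'a) \<Rightarrow> ('a \<times> 'b) monoid" where
  "semidirect_product N H \<theta> =
     \<lparr>carrier = carrier N \<times> carrier H,
      monoid.mult = (\<lambda>(a, p) (b, q). (a \<otimes>\<^bsub>N\<^esub> \<theta> p b, p \<otimes>\<^bsub>H\<^esub> q)),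
      one = (\<one>\<^bsub>N\<^esub>, \<one>\<^bsub>H\<^esub>)\<rparr>"

text \<open>The inverse makes the permutation of coordinates a left action.\<close>

definition coord_perm :: "nat \<Rightarrow> (nat \<Rightarrow> nat) \<Rightarrow> (nat \<Rightarrow> int) \<Rightarrow> (nat \<Rightarrow> int)" where
  "coord_perm n p a = (\<lambda>i\<in>{1..n}. a (inv_into UNIV p i))"

definition C2n_semidirect_Sn :: "nat \<Rightarrow> ((nat \<Rightarrow> int) \<times> (nat \<Rightarrow> nat)) monoid" where
  "C2n_semidirect_Sn n =
     semidirect_product (product_group {1..n} (\<lambda>_. integer_mod_group 2)) (sym_group n) (coord_perm n)"


section \<open>Magic-faced hypercubes\<close>

text \<open>Only the values of a labeling on \<open>cube_verts n\<close> are relevant. A cube of dimension less than 2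
  has no faces, so there the face condition is vacuous.\<close>

definition magic_faced :: "nat \<Rightarrow> ((nat \<Rightarrow> int) \<Rightarrow> nat) \<Rightarrow> bool" where
  "magic_faced n f \<longleftrightarrow>
     bij_betw f (cube_verts n) {1..2 ^ n} \<and> (\<exists>S. \<forall>F\<in>cube_faces n. sum f F = S)"

definition associative :: "nat \<Rightarrow> ((nat \<Rightarrow> int) \<Rightarrow> nat) \<Rightarrow> bool" where
  "associative n f \<longleftrightarrow> (\<exists>c. \<forall>u v. cube_antipodal n u v \<longrightarrow> f u + f v = c)"

end

theory Submission
  imports Defs "HOL-Library.Nat_Bijection"
begin

text \<open>Rescale the labels to \<open>h = 2 f - (2^n + 1)\<close>, so that all faces and all antipodal pairs have sum
  zero. Multiplying \<open>h\<close> by the parity sign \<open>(-1)^{|x|}\<close> turns the face condition into the vanishing of all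
  mixed second differences, so the product \<open>k\<close> is an affine function of the coordinates. If \<open>n\<close> is odd,
  \<open>k\<close> is invariant under the antipodal map, hence constant, and \<open>h\<close> takes at most two values. If \<open>n\<close> is
  even, \<open>k\<close> is antisymmetric and a bijection onto the odd numbers between \<open>-2^n\<close> and \<open>2^n\<close>; up to
  reflections its coefficients are nonnegative weights all of whose subset sums are distinct and fill an
  interval, which forces the weights to be powers of two in some order. A reflection in \<open>K\<close> changes
  the parity sign by \<open>(-1)^{|K|}\<close>, and composing with the antipodal map repairs this because \<open>k\<close> is
  antisymmetric.\<close>

section \<open>Flipping coordinates\<close>

definition cube_zero :: "nat \<Rightarrow> nat \<Rightarrow> int" where
  "cube_zero n = (\<lambda>i\<in>{1..n}. 0)"

text \<open>Subtraction from 1 makes this an involution on all functions, so the rewrite rules on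
  repeated flips need no membership in the cube.\<close>

definition cube_flip :: "nat \<Rightarrow> (nat \<Rightarrow> int) \<Rightarrow> nat \<Rightarrow> int" where
  "cube_flip i x = x(i := 1 - x i)"

lemma cube_verts_iff:
  "x \<in> cube_verts n \<longleftrightarrow> (\<forall>i\<in>{1..n}. x i = 0 \<or> x i = 1) \<and> x \<in> extensional {1..n}"
  unfolding cube_verts_def PiE_iff by auto

lemma cube_verts_cases:
  assumes "x \<in> cube_verts n" "i \<in> {1..n}"
  obtains "x i = 0" | "x i = 1"
  using assms unfolding cube_verts_iff by blast

lemma cube_verts_eqI:
  assumes "x \<in> cube_verts n" "y \<in> cube_verts n" "\<And>i. i \<in> {1..n} \<Longrightarrow> x i = y i"
  shows "x = y"
  using assms unfolding cube_verts_iff by (meson extensionalityI)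

lemma finite_cube_verts [simp]: "finite (cube_verts n)"
  unfolding cube_verts_def by (intro finite_PiE) auto

lemma card_cube_verts [simp]: "card (cube_verts n) = 2 ^ n"
  unfolding cube_verts_def by (simp add: card_PiE numeral_2_eq_2)

lemma cube_zero_in [simp]: "cube_zero n \<in> cube_verts n"
  by (simp add: cube_verts_iff cube_zero_def)

lemma cube_flip_in [simp]:
  assumes "x \<in> cube_verts n" "i \<in> {1..n}"
  shows "cube_flip i x \<in> cube_verts n"
  using assms unfolding cube_verts_iff cube_flip_def extensional_def by auto

lemma cube_flip_flip [simp]: "cube_flip i (cube_flip i x) = x"
  by (simp add: cube_flip_def fun_eq_iff)

lemma cube_flip_commute: "i \<noteq> j \<Longrightarrow> cube_flip i (cube_flip j x) = cube_flip j (cube_flip i x)"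
  by (auto simp: cube_flip_def fun_eq_iff)

lemma cube_flip_apply: "cube_flip i x j = (if j = i then 1 - x i else x j)"
  by (simp add: cube_flip_def)

text \<open>Equality would make 1 even. Hence a flip moves every integer-valued function, not only
  0/1 vectors.\<close>

lemma int_neq_one_minus: "(x::int) \<noteq> 1 - x" "1 - x \<noteq> x"
  by presburger+

lemma cube_flip_neq: "cube_flip i x j \<noteq> x j \<longleftrightarrow> j = i"
  using int_neq_one_minus[of "x i"] by (auto simp: cube_flip_apply)

lemma cube_flip_neq_self [simp]: "cube_flip i x \<noteq> x" "x \<noteq> cube_flip i x"
  by (metis cube_flip_neq)+

lemma cube_flip_eq_iff [simp]: "cube_flip i x = cube_flip j x \<longleftrightarrow> i = j"
  by (metis cube_flip_neq)

text \<open>Every vertex is reached from the origin by turning on one coordinate at a time; the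
  induction is on the number of ones.\<close>

lemma cube_induct [consumes 1, case_names zero flip]:
  assumes "x \<in> cube_verts n"
    and zero: "P (cube_zero n)"
    and flip: "\<And>x i. x \<in> cube_verts n \<Longrightarrow> i \<in> {1..n} \<Longrightarrow> x i = 0 \<Longrightarrow> P x \<Longrightarrow> P (cube_flip i x)"
  shows "P x"
  using assms(1)
proof (induction "card {i\<in>{1..n}. x i = 1}" arbitrary: x rule: less_induct)
  case less
  show ?case
  proof (cases "\<exists>i\<in>{1..n}. x i = 1")
    case False
    then have "x = cube_zero n"
      using less.prems by (intro cube_verts_eqI[of _ n]) (auto simp: cube_zero_def cube_verts_iff)
    then show ?thesis
      using zero by simp
  next
    case True
    then obtain i where i: "i \<in> {1..n}" "x i = 1"
      by blast
    have "{j\<in>{1..n}. cube_flip i x j = 1} \<subset> {j\<in>{1..n}. x j = 1}"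
      using i by (auto simp: cube_flip_apply)
    then have "card {j\<in>{1..n}. cube_flip i x j = 1} < card {j\<in>{1..n}. x j = 1}"
      by (intro psubset_card_mono) auto
    then have "P (cube_flip i x)"
      using less.hyps[of "cube_flip i x"] less.prems i by simp
    moreover have "cube_flip i x i = 0"
      using i by (simp add: cube_flip_apply)
    ultimately have "P (cube_flip i (cube_flip i x))"
      using flip[of "cube_flip i x" i] cube_flip_in[OF less.prems i(1)] i(1) by blast
    then show ?thesis
      by simp
  qed
qed

text \<open>Distinct bits are complementary, so the single differing coordinate is a flip. Edges
  thereby acquire a direction \<open>i\<close>.\<close>

lemma cube_adj_iff_flip:
  "cube_adj n u v \<longleftrightarrow> u \<in> cube_verts n \<and> (\<exists>i\<in>{1..n}. v = cube_flip i u)"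
proof
  assume *: "cube_adj n u v"
  then obtain i where i: "i \<in> {1..n}" "u i \<noteq> v i" "\<And>j. j \<in> {1..n} \<Longrightarrow> u j \<noteq> v j \<Longrightarrow> j = i"
    unfolding cube_adj_def by blast
  have V: "u \<in> cube_verts n" "v \<in> cube_verts n"
    using * unfolding cube_adj_def by blast+
  have "v j = cube_flip i u j" if "j \<in> {1..n}" for j
  proof (cases "j = i")
    case True
    have "u i = 0 \<or> u i = 1" "v i = 0 \<or> v i = 1"
      using i(1) V by (auto simp: cube_verts_iff)
    then show ?thesis
      using i(2) True by (auto simp: cube_flip_apply)
  next
    case False
    then show ?thesis
      using i(3)[OF that] by (simp add: cube_flip_apply) metis
  qed
  then have "v = cube_flip i u"
    using V i(1) by (intro cube_verts_eqI[of _ n]) auto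
  then show "u \<in> cube_verts n \<and> (\<exists>i\<in>{1..n}. v = cube_flip i u)"
    using V i by blast
next
  assume "u \<in> cube_verts n \<and> (\<exists>i\<in>{1..n}. v = cube_flip i u)"
  then show "cube_adj n u v"
    unfolding cube_adj_def by (metis cube_flip_in cube_flip_neq)
qed

section \<open>The automorphism group\<close>

text \<open>The map x -> a + Px over the field with two elements. It is extensional on the cube
  because elements of \<open>Bij\<close> must be, and takes a pair so that it is defined on the
  semidirect product.\<close>

definition cube_affine :: "nat \<Rightarrow> (nat \<Rightarrow> int) \<times> (nat \<Rightarrow> nat) \<Rightarrow> (nat \<Rightarrow> int) \<Rightarrow> (nat \<Rightarrow> int)" where
  "cube_affine n = (\<lambda>(a, p). \<lambda>x\<in>cube_verts n. \<lambda>i\<in>{1..n}. (a i + coord_perm n p x i) mod 2)"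

lemma cube_affine_apply:
  "x \<in> cube_verts n \<Longrightarrow> i \<in> {1..n} \<Longrightarrow> cube_affine n (a, p) x i = (a i + x (inv_into UNIV p i)) mod 2"
  by (simp add: cube_affine_def coord_perm_def)

lemma cube_affine_in [simp]:
  "x \<in> cube_verts n \<Longrightarrow> cube_affine n (a, p) x \<in> cube_verts n"
  unfolding cube_verts_iff[of "cube_affine n (a, p) x"] by (simp add: cube_affine_def mod2_eq_if)

lemma permutes_inv_in: "p permutes A \<Longrightarrow> i \<in> A \<Longrightarrow> inv_into UNIV p i \<in> A"
  by (metis permutes_inv permutes_in_image)

text \<open>Translation does not affect differences, so only the permutation acts on edge
  directions.\<close>

lemma cube_affine_flip:
  assumes "x \<in> cube_verts n" "p permutes {1..n}" "i \<in> {1..n}"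
  shows "cube_affine n (a, p) (cube_flip i x) = cube_flip (p i) (cube_affine n (a, p) x)"
proof (rule cube_verts_eqI[of _ n])
  have pi: "p i \<in> {1..n}"
    using assms(3) permutes_in_image[OF assms(2), of i] by blast
  then show "cube_flip (p i) (cube_affine n (a, p) x) \<in> cube_verts n"
    using assms by simp
  fix j assume j: "j \<in> {1..n}"
  have eq: "inv_into UNIV p j = i \<longleftrightarrow> j = p i"
    using permutes_inv_eq[OF assms(2), of j i] by auto
  have "(b + (1 - c)) mod 2 = 1 - (b + c) mod 2" for b c :: int
    by presburger
  then show "cube_affine n (a, p) (cube_flip i x) j = cube_flip (p i) (cube_affine n (a, p) x) j"
    using eq assms cube_affine_apply[OF cube_flip_in[OF assms(1,3)] j, of a p]
      cube_affine_apply[OF assms(1) j, of a p]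
    by (cases "j = p i") (simp_all add: cube_flip_apply)
qed (use assms in simp)

lemma cube_affine_Bij:
  assumes "p permutes {1..n}"
  shows "cube_affine n (a, p) \<in> Bij (cube_verts n)"
proof -
  have "inj_on (cube_affine n (a, p)) (cube_verts n)"
  proof (intro inj_onI cube_verts_eqI[of _ n])
    fix x y i
    assume *: "x \<in> cube_verts n" "y \<in> cube_verts n"
      "cube_affine n (a, p) x = cube_affine n (a, p) y" and i: "i \<in> {1..n}"
    have pi: "p i \<in> {1..n}" "inv_into UNIV p (p i) = i"
      using assms i permutes_in_image permutes_inverses(2) by metis+
    \<comment> \<open>Coordinate \<open>p i\<close> of the image holds the bit \<open>x i\<close> up
      to the shift \<open>a (p i)\<close>.\<close>
    have "(a (p i) + x i) mod 2 = (a (p i) + y i) mod 2"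
      using *(3) cube_affine_apply[OF *(1) pi(1), of a p] cube_affine_apply[OF *(2) pi(1), of a p] pi(2)
      by simp
    moreover have "x i = 0 \<or> x i = 1" "y i = 0 \<or> y i = 1"
      using * i by (auto simp: cube_verts_iff)
    ultimately show "x i = y i"
      by presburger
  qed auto
  moreover have "cube_affine n (a, p) ` cube_verts n = cube_verts n"
    using calculation by (intro endo_inj_surj) auto
  ultimately have "bij_betw (cube_affine n (a, p)) (cube_verts n) (cube_verts n)"
    by (simp add: bij_betw_def)
  then show ?thesis
    by (auto simp: Bij_def cube_affine_def)
qed

lemma cube_affine_aut:
  assumes "p permutes {1..n}"
  shows "cube_affine n (a, p) \<in> carrier (cube_aut n)"
proof -
  let ?f = "cube_affine n (a, p)"
  have inj: "inj_on ?f (cube_verts n)"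
    using cube_affine_Bij[OF assms] by (auto simp: Bij_def bij_betw_def)
  have "cube_adj n (?f u) (?f v) \<longleftrightarrow> cube_adj n u v"
    if uv: "u \<in> cube_verts n" "v \<in> cube_verts n" for u v
  proof
    assume "cube_adj n u v"
    then obtain i where "i \<in> {1..n}" "v = cube_flip i u"
      by (auto simp: cube_adj_iff_flip)
    then show "cube_adj n (?f u) (?f v)"
      using assms uv permutes_in_image[OF assms, of i]
      by (auto simp: cube_adj_iff_flip cube_affine_flip intro!: bexI[of _ "p i"])
  next
    assume "cube_adj n (?f u) (?f v)"
    then obtain i where i: "i \<in> {1..n}" "?f v = cube_flip i (?f u)"
      by (auto simp: cube_adj_iff_flip)
    \<comment> \<open>Direction \<open>i\<close> in the image can only come from direction p^-1(i);
      injectivity then identifies \<open>v\<close>.\<close>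
    have j: "inv_into UNIV p i \<in> {1..n}" "p (inv_into UNIV p i) = i"
      using assms i permutes_inv_in permutes_inverses(1) by metis+
    then have "?f v = ?f (cube_flip (inv_into UNIV p i) u)"
      using cube_affine_flip[OF uv(1) assms j(1), of a] i by simp
    then have "v = cube_flip (inv_into UNIV p i) u"
      using inj uv j by (auto dest: inj_onD)
    then show "cube_adj n u v"
      using uv j by (auto simp: cube_adj_iff_flip)
  qed
  then show ?thesis
    using cube_affine_Bij[OF assms] by (simp add: cube_aut_def)
qed

section \<open>The semidirect product realised by affine maps\<close>

lemma carrier_C2n_semidirect_Sn:
  "carrier (C2n_semidirect_Sn n) = cube_verts n \<times> {p. p permutes {1..n}}"
proof -
  have "{0..<2::int} = {0, 1}"
    by (rule Set.set_eqI) (simp, presburger)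
  then have "carrier (integer_mod_group 2) = {0, 1}"
    by (simp add: carrier_integer_mod_group)
  then show ?thesis
    by (simp add: C2n_semidirect_Sn_def semidirect_product_def sym_group_def cube_verts_def)
qed

lemma mult_C2n_semidirect_Sn:
  "(a, p) \<otimes>\<^bsub>C2n_semidirect_Sn n\<^esub> (b, q) = (\<lambda>i\<in>{1..n}. (a i + coord_perm n p b i) mod 2, p \<circ> q)"
  by (simp add: C2n_semidirect_Sn_def semidirect_product_def sym_group_def)

lemma mult_C2n_semidirect_Sn_closed:
  assumes "g \<in> carrier (C2n_semidirect_Sn n)" "h \<in> carrier (C2n_semidirect_Sn n)"
  shows "g \<otimes>\<^bsub>C2n_semidirect_Sn n\<^esub> h \<in> carrier (C2n_semidirect_Sn n)"
proof -
  obtain a p b q where gh: "g = (a, p)" "h = (b, q)" "p permutes {1..n}" "q permutes {1..n}"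
    using assms unfolding carrier_C2n_semidirect_Sn by blast
  have "(\<lambda>i\<in>{1..n}. (a i + coord_perm n p b i) mod 2) \<in> cube_verts n"
    unfolding cube_verts_iff by (auto simp: mod2_eq_if)
  moreover have "p \<circ> q permutes {1..n}"
    using gh by (simp add: permutes_compose)
  ultimately show ?thesis
    by (simp add: carrier_C2n_semidirect_Sn mult_C2n_semidirect_Sn gh)
qed

lemma mult_cube_aut:
  assumes "f \<in> carrier (cube_aut n)" "g \<in> carrier (cube_aut n)"
  shows "f \<otimes>\<^bsub>cube_aut n\<^esub> g = compose (cube_verts n) f g"
  using assms by (simp add: cube_aut_def BijGroup_def)

text \<open>This is a + P(b + Qx) = (a + Pb) + PQx, computed bitwise modulo 2.\<close>

lemma cube_affine_mult:
  assumes "p permutes {1..n}" "q permutes {1..n}"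
  shows "cube_affine n ((a, p) \<otimes>\<^bsub>C2n_semidirect_Sn n\<^esub> (b, q)) =
    compose (cube_verts n) (cube_affine n (a, p)) (cube_affine n (b, q))"
proof (rule extensionalityI[of _ "cube_verts n"])
  let ?c = "\<lambda>i\<in>{1..n}. (a i + coord_perm n p b i) mod 2"
  fix x assume x: "x \<in> cube_verts n"
  have "cube_affine n (?c, p \<circ> q) x = cube_affine n (a, p) (cube_affine n (b, q) x)"
  proof (rule cube_verts_eqI[of _ n])
    fix i assume i: "i \<in> {1..n}"
    define j where "j = inv_into UNIV p i"
    have j: "j \<in> {1..n}"
      unfolding j_def using assms(1) i by (rule permutes_inv_in)
    have "inv_into UNIV (p \<circ> q) i = inv_into UNIV q j"
      using o_inv_distrib[OF permutes_bij[OF assms(1)] permutes_bij[OF assms(2)]] by (simp add: j_def)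
    then have "cube_affine n (?c, p \<circ> q) x i = ((a i + b j) mod 2 + x (inv_into UNIV q j)) mod 2"
      using i by (simp only: cube_affine_apply[OF x i]) (simp add: coord_perm_def j_def)
    also have "\<dots> = (a i + (b j + x (inv_into UNIV q j)) mod 2) mod 2"
      by presburger
    also have "\<dots> = cube_affine n (a, p) (cube_affine n (b, q) x) i"
      by (simp only: cube_affine_apply[OF cube_affine_in[OF x] i] cube_affine_apply[OF x j] flip: j_def)
    finally show "cube_affine n (?c, p \<circ> q) x i = cube_affine n (a, p) (cube_affine n (b, q) x) i" .
  qed (intro cube_affine_in x)+
  then show "cube_affine n ((a, p) \<otimes>\<^bsub>C2n_semidirect_Sn n\<^esub> (b, q)) x =
    compose (cube_verts n) (cube_affine n (a, p)) (cube_affine n (b, q)) x"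
    by (simp only: mult_C2n_semidirect_Sn compose_eq[OF x])
qed (simp_all add: mult_C2n_semidirect_Sn cube_affine_def compose_def)

lemma cube_affine_zero:
  assumes "a \<in> cube_verts n" "p permutes {1..n}"
  shows "cube_affine n (a, p) (cube_zero n) = a"
proof (rule cube_verts_eqI[of _ n])
  fix i assume i: "i \<in> {1..n}"
  then have "cube_zero n (inv_into UNIV p i) = 0"
    using permutes_inv_in[OF assms(2) i] by (simp add: cube_zero_def)
  then show "cube_affine n (a, p) (cube_zero n) i = a i"
    using i assms(1) cube_affine_apply[OF cube_zero_in i, of a p]
    by (auto elim: cube_verts_cases)
qed (use assms in auto)

text \<open>The pair can be read off from the map: \<open>a\<close> is the image of the origin, and
  \<open>p i\<close> is the direction of the image of the edge leaving the origin in direction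
  \<open>i\<close>.\<close>

lemma inj_on_cube_affine: "inj_on (cube_affine n) (carrier (C2n_semidirect_Sn n))"
proof (rule inj_onI, clarify)
  fix a p b q
  assume "(a, p) \<in> carrier (C2n_semidirect_Sn n)" "(b, q) \<in> carrier (C2n_semidirect_Sn n)"
  then have *: "a \<in> cube_verts n" "b \<in> cube_verts n" "p permutes {1..n}" "q permutes {1..n}"
    by (auto simp: carrier_C2n_semidirect_Sn)
  assume eq: "cube_affine n (a, p) = cube_affine n (b, q)"
  have "a = b"
    using cube_affine_zero * eq by metis
  moreover have "p i = q i" for i
  proof (cases "i \<in> {1..n}")
    case True
    then show ?thesis
      using cube_affine_flip[OF cube_zero_in *(3), of i a] cube_affine_flip[OF cube_zero_in *(4), of i b] eq
      by simp
  next
    case False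
    then show ?thesis
      using * by (simp add: permutes_def)
  qed
  ultimately show "a = b \<and> p = q"
    by auto
qed

text \<open>An automorphism maps squares to squares, so it sends all edges of one direction to edges of a
  common direction.\<close>

lemma cube_aut_imp_affine:
  assumes "f \<in> carrier (cube_aut n)"
  obtains a p where "a \<in> cube_verts n" "p permutes {1..n}" "f = cube_affine n (a, p)"
proof -
  let ?V = "cube_verts n"
  have bij: "bij_betw f ?V ?V" and ext: "f \<in> extensional ?V"
    and adj: "\<And>u v. u \<in> ?V \<Longrightarrow> v \<in> ?V \<Longrightarrow> cube_adj n (f u) (f v) \<longleftrightarrow> cube_adj n u v"
    using assms by (auto simp: cube_aut_def Bij_def)
  have fV: "f x \<in> ?V" if "x \<in> ?V" for x
    using bij that by (auto simp: bij_betw_def)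
  have f_eq: "f x = f y \<longleftrightarrow> x = y" if "x \<in> ?V" "y \<in> ?V" for x y
    using bij that by (auto simp: bij_betw_def inj_on_def)
  have "\<exists>j\<in>{1..n}. f (cube_flip i x) = cube_flip j (f x)" if "x \<in> ?V" "i \<in> {1..n}" for x i
    using adj[of x "cube_flip i x"] that by (auto simp: cube_adj_iff_flip)
  \<comment> \<open>\<open>d x i\<close> is the direction of the image of the edge at
    \<open>x\<close> in direction \<open>i\<close>.\<close>
  then obtain d where d: "\<And>x i. x \<in> ?V \<Longrightarrow> i \<in> {1..n} \<Longrightarrow> d x i \<in> {1..n}"
    "\<And>x i. x \<in> ?V \<Longrightarrow> i \<in> {1..n} \<Longrightarrow> f (cube_flip i x) = cube_flip (d x i) (f x)"
    by metis
  have d_inj: "d x i \<noteq> d x j" if "x \<in> ?V" "i \<in> {1..n}" "j \<in> {1..n}" "i \<noteq> j" for x i j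
    using d(2)[OF that(1,2)] d(2)[OF that(1,3)] f_eq that by (metis cube_flip_eq_iff cube_flip_in)
  have d_flip: "d (cube_flip j x) i = d x i" if x: "x \<in> ?V" "i \<in> {1..n}" "j \<in> {1..n}" for x i j
  proof (cases "i = j")
    case True
    have "f (cube_flip i (cube_flip i x)) = cube_flip (d (cube_flip i x) i) (cube_flip (d x i) (f x))"
      using x d by (metis cube_flip_in)
    then show ?thesis
      using True by (metis cube_flip_eq_iff cube_flip_flip)
  next
    case False
    \<comment> \<open>The two paths around the square at \<open>x\<close> have images with
      directions \<open>b\<close>, \<open>c\<close> and \<open>a\<close>, \<open>e\<close> that end
      at the same vertex. Since \<open>b\<close> differs from \<open>a\<close> and \<open>c\<close>,
      coordinate \<open>b\<close> is flipped once on the first path, so it must be \<open>e\<close>;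
      then \<open>a = c\<close>.\<close>
    define b where "b = d x j"
    define c where "c = d (cube_flip j x) i"
    define e where "e = d (cube_flip i x) j"
    define a where "a = d x i"
    have "a \<noteq> b"
      using d_inj False x by (auto simp: a_def b_def)
    have 1: "f (cube_flip i (cube_flip j x)) = cube_flip c (cube_flip b (f x))"
      using x d by (simp add: b_def c_def)
    have 2: "f (cube_flip j (cube_flip i x)) = cube_flip e (cube_flip a (f x))"
      using x d by (simp add: a_def e_def)
    have "cube_flip i (cube_flip j x) \<noteq> x"
      using False by (metis cube_flip_eq_iff cube_flip_flip)
    then have "c \<noteq> b"
      using 1 x f_eq by (metis cube_flip_flip cube_flip_in)
    have 3: "cube_flip c (cube_flip b (f x)) = cube_flip e (cube_flip a (f x))"
      using 1 2 False cube_flip_commute by metis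
    have "b = e"
      using fun_cong[OF 3, of b] \<open>c \<noteq> b\<close> \<open>a \<noteq> b\<close> int_neq_one_minus[of "f x b"]
      by (auto simp: cube_flip_apply split: if_splits)
    then have "a = c"
      using fun_cong[OF 3, of a] \<open>a \<noteq> b\<close> int_neq_one_minus[of "f x a"]
      by (auto simp: cube_flip_apply split: if_splits)
    then show ?thesis
      by (simp add: a_def c_def)
  qed
  have d_const: "d x i = d (cube_zero n) i" if "x \<in> ?V" "i \<in> {1..n}" for x i
    using that by (induction rule: cube_induct) (simp_all add: d_flip)
  define p where "p i = (if i \<in> {1..n} then d (cube_zero n) i else i)" for i
  have "inj_on p {1..n}"
    by (intro inj_onI) (metis cube_zero_in d_inj p_def)
  moreover have "p ` {1..n} \<subseteq> {1..n}"
    using d by (auto simp: p_def)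
  ultimately have p: "p permutes {1..n}"
    using endo_inj_surj[of "{1..n}" p] by (intro bij_imp_permutes) (auto simp: bij_betw_def p_def)
  \<comment> \<open>Both maps agree at the origin and send each edge direction to the same
    direction, so they agree along every path from the origin.\<close>
  have "cube_affine n (f (cube_zero n), p) x = f x" if "x \<in> ?V" for x
    using that
  proof (induction rule: cube_induct)
    case zero
    then show ?case
      using p fV by (simp add: cube_affine_zero)
  next
    case (flip x i)
    have "p i = d (cube_zero n) i"
      using flip by (simp add: p_def)
    then show ?case
      using flip cube_affine_flip[OF flip(1) p flip(2), of "f (cube_zero n)"] d(2)[OF flip(1,2)]
        d_const[OF flip(1,2)] by simp
  qed
  then have "f = cube_affine n (f (cube_zero n), p)"
    using ext by (intro extensionalityI[of _ ?V]) (auto simp: cube_affine_def)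
  then show ?thesis
    using that p fV by (meson cube_zero_in)
qed

lemma iso_cube_aut: "cube_aut n \<cong> C2n_semidirect_Sn n"
proof -
  let ?C = "C2n_semidirect_Sn n" and ?A = "cube_aut n"
  have bij: "bij_betw (cube_affine n) (carrier ?C) (carrier ?A)"
    unfolding bij_betw_def using inj_on_cube_affine[of n]
    by (auto simp: carrier_C2n_semidirect_Sn cube_affine_aut intro: image_eqI elim!: cube_aut_imp_affine)
  \<comment> \<open>\<open>cube_affine\<close> goes from the semidirect product to the
    automorphisms, while the isomorphism is wanted in the opposite direction.\<close>
  define h where "h = inv_into (carrier ?C) (cube_affine n)"
  have h: "bij_betw h (carrier ?A) (carrier ?C)"
    unfolding h_def using bij by (rule bij_betw_inv_into)
  have "h (f \<otimes>\<^bsub>?A\<^esub> g) = h f \<otimes>\<^bsub>?C\<^esub> h g" if fg: "f \<in> carrier ?A" "g \<in> carrier ?A" for f g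
  proof -
    obtain u v where uv: "u \<in> carrier ?C" "f = cube_affine n u" "v \<in> carrier ?C" "g = cube_affine n v"
      using fg bij unfolding bij_betw_def by blast
    have "f \<otimes>\<^bsub>?A\<^esub> g = cube_affine n (u \<otimes>\<^bsub>?C\<^esub> v)"
      using uv fg by (cases u, cases v) (simp add: mult_cube_aut cube_affine_mult carrier_C2n_semidirect_Sn)
    then show ?thesis
      using uv mult_C2n_semidirect_Sn_closed[OF uv(1,3)] inj_on_cube_affine[of n]
      by (simp add: h_def)
  qed
  then have "h \<in> iso ?A ?C"
    using h by (auto simp: iso_def hom_def bij_betw_def)
  then show ?thesis
    by (rule is_isoI)
qed

section \<open>Antipodes, signs and faces\<close>

definition cube_anti :: "nat \<Rightarrow> (nat \<Rightarrow> int) \<Rightarrow> (nat \<Rightarrow> int)" where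
  "cube_anti n x = (\<lambda>i\<in>{1..n}. 1 - x i)"

text \<open>On cube vertices each factor is 1 or -1 according to the bit, so this is the parity
  sign.\<close>

definition cube_sgn :: "nat \<Rightarrow> (nat \<Rightarrow> int) \<Rightarrow> int" where
  "cube_sgn n x = (\<Prod>i\<in>{1..n}. 1 - 2 * x i)"

lemma cube_anti_in [simp]: "x \<in> cube_verts n \<Longrightarrow> cube_anti n x \<in> cube_verts n"
  unfolding cube_verts_iff by (auto simp: cube_anti_def)

lemma cube_anti_anti [simp]: "x \<in> cube_verts n \<Longrightarrow> cube_anti n (cube_anti n x) = x"
  by (rule cube_verts_eqI[of _ n]) (simp_all, simp add: cube_anti_def)

lemma bij_betw_cube_anti: "bij_betw (cube_anti n) (cube_verts n) (cube_verts n)"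
  by (rule bij_betw_byWitness[of _ "cube_anti n"]) auto

lemma cube_anti_flip:
  "i \<in> {1..n} \<Longrightarrow> cube_anti n (cube_flip i x) = cube_flip i (cube_anti n x)"
  by (auto simp: cube_anti_def cube_flip_def fun_eq_iff)

lemma cube_antipodal_iff:
  "cube_antipodal n u v \<longleftrightarrow> u \<in> cube_verts n \<and> v = cube_anti n u"
proof
  assume *: "cube_antipodal n u v"
  then have V: "u \<in> cube_verts n" "v \<in> cube_verts n" and "\<forall>i\<in>{1..n}. u i \<noteq> v i"
    by (auto simp: cube_antipodal_def)
  then have "v i = 1 - u i" if "i \<in> {1..n}" for i
    using that unfolding cube_verts_iff by fastforce
  then have "v = cube_anti n u"
    using V by (intro cube_verts_eqI[of _ n]) (simp_all, simp add: cube_anti_def)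
  then show "u \<in> cube_verts n \<and> v = cube_anti n u"
    using V by simp
next
  assume "u \<in> cube_verts n \<and> v = cube_anti n u"
  then show "cube_antipodal n u v"
    by (auto simp: cube_antipodal_def) (auto simp: cube_anti_def int_neq_one_minus)
qed

lemma sum_cube_flip:
  fixes a :: "nat \<Rightarrow> int"
  assumes "i \<in> {1..n}"
  shows "(\<Sum>j\<in>{1..n}. cube_flip i x j * a j) = (\<Sum>j\<in>{1..n}. x j * a j) + (1 - 2 * x i) * a i"
proof -
  have "(\<Sum>j\<in>{1..n} - {i}. cube_flip i x j * a j) = (\<Sum>j\<in>{1..n} - {i}. x j * a j)"
    by (intro sum.cong) (auto simp: cube_flip_apply)
  then show ?thesis
    using assms sum.remove[of "{1..n}" i "\<lambda>j. cube_flip i x j * a j"]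
      sum.remove[of "{1..n}" i "\<lambda>j. x j * a j"]
    by (simp add: cube_flip_apply algebra_simps)
qed

lemma cube_sgn_flip: "i \<in> {1..n} \<Longrightarrow> cube_sgn n (cube_flip i x) = - cube_sgn n x"
proof -
  assume i: "i \<in> {1..n}"
  have "(\<Prod>j\<in>{1..n} - {i}. 1 - 2 * cube_flip i x j) = (\<Prod>j\<in>{1..n} - {i}. 1 - 2 * x j)"
    by (intro prod.cong) (auto simp: cube_flip_apply)
  then show ?thesis
    using i prod.remove[of "{1..n}" i "\<lambda>j. 1 - 2 * cube_flip i x j"]
      prod.remove[of "{1..n}" i "\<lambda>j. 1 - 2 * x j"]
    by (simp add: cube_sgn_def) (simp add: cube_flip_apply algebra_simps)
qed

lemma cube_sgn_cases:
  assumes "x \<in> cube_verts n"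
  shows "cube_sgn n x = 1 \<or> cube_sgn n x = - 1"
  using assms by (induction rule: cube_induct) (auto simp: cube_sgn_flip, simp add: cube_sgn_def cube_zero_def)

lemma cube_sgn_square:
  assumes "x \<in> cube_verts n"
  shows "cube_sgn n x * (cube_sgn n x * c) = c"
  using cube_sgn_cases[OF assms] by auto

text \<open>Each of the \<open>n\<close> factors changes sign. Through this sign the parity of
  \<open>n\<close> enters the arguments below.\<close>

lemma cube_sgn_anti: "cube_sgn n (cube_anti n x) = (- 1) ^ n * cube_sgn n x"
proof -
  have "cube_sgn n (cube_anti n x) = (\<Prod>i\<in>{1..n}. (- 1) * (1 - 2 * x i))"
    unfolding cube_sgn_def by (intro prod.cong) (auto simp: cube_anti_def)
  then show ?thesis
    by (simp only: prod.distrib cube_sgn_def) simp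
qed

text \<open>Both sides change sign under every flip, whatever its direction becomes, and the origin
  is sent to \<open>a\<close>.\<close>

lemma cube_sgn_affine:
  assumes "a \<in> cube_verts n" "p permutes {1..n}" "x \<in> cube_verts n"
  shows "cube_sgn n (cube_affine n (a, p) x) = cube_sgn n a * cube_sgn n x"
  using assms(3)
proof (induction rule: cube_induct)
  case zero
  have "cube_sgn n (cube_zero n) = 1"
    by (simp add: cube_sgn_def cube_zero_def)
  then show ?case
    using assms by (simp add: cube_affine_zero)
next
  case (flip x i)
  then have "p i \<in> {1..n}"
    using assms(2) permutes_in_image[OF assms(2), of i] by blast
  then show ?case
    using flip assms by (simp add: cube_affine_flip cube_sgn_flip)
qed

text \<open>Complementing the translation complements every bit of the image; this later repairs a
  wrong global sign.\<close>

lemma cube_affine_anti: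
  assumes "x \<in> cube_verts n"
  shows "cube_affine n (cube_anti n a, p) x = cube_anti n (cube_affine n (a, p) x)"
proof (rule cube_verts_eqI[of _ n])
  fix i assume i: "i \<in> {1..n}"
  have "((1 - a i) + x (inv_into UNIV p i)) mod 2 = 1 - (a i + x (inv_into UNIV p i)) mod 2"
    by presburger
  then show "cube_affine n (cube_anti n a, p) x i = cube_anti n (cube_affine n (a, p) x) i"
    using i assms by (simp add: cube_affine_apply cube_anti_def)
qed (use assms in auto)

section \<open>Faces as squares spanned by two flips\<close>

lemma cube_face_eq:
  assumes "x \<in> cube_verts n" "i \<in> {1..n}" "j \<in> {1..n}" "i \<noteq> j"
  shows "{y \<in> cube_verts n. \<forall>k\<in>{1..n} - {i, j}. y k = x k} =
    {x, cube_flip i x, cube_flip j x, cube_flip i (cube_flip j x)}" (is "?L = ?R")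
proof
  show "?R \<subseteq> ?L"
    using assms by (auto simp: cube_flip_apply)
  show "?L \<subseteq> ?R"
  proof
    fix y assume y: "y \<in> ?L"
    \<comment> \<open>\<open>z\<close> flips \<open>x\<close> in exactly those of the two free
      coordinates where \<open>y\<close> differs from it.\<close>
    define z where "z = (if y i = x i then id else cube_flip i) ((if y j = x j then id else cube_flip j) x)"
    have "z \<in> cube_verts n"
      using assms by (simp add: z_def)
    moreover have flip: "y k = 1 - x k" if "y k \<noteq> x k" "k \<in> {1..n}" for k
      using that y assms(1) unfolding cube_verts_iff by fastforce
    moreover have "y k = z k" if "k \<in> {1..n}" for k
      using that y assms flip[of i] flip[of j] by (auto simp: z_def cube_flip_apply)
    ultimately have "y = z"
      using y by (auto intro!: cube_verts_eqI[of _ n])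
    moreover have "z \<in> ?R"
      by (simp add: z_def)
    ultimately show "y \<in> ?R"
      by simp
  qed
qed

text \<open>Polymorphic in order to serve both the natural-number labels and the centred integer
  labels.\<close>

definition cube_square_sum :: "((nat \<Rightarrow> int) \<Rightarrow> 'a::comm_monoid_add) \<Rightarrow> nat \<Rightarrow> nat \<Rightarrow> (nat \<Rightarrow> int) \<Rightarrow> 'a" where
  "cube_square_sum f i j x = f x + f (cube_flip i x) + f (cube_flip j x) + f (cube_flip i (cube_flip j x))"

lemma sum_cube_face:
  assumes "x \<in> cube_verts n" "i \<in> {1..n}" "j \<in> {1..n}" "i \<noteq> j"
  shows "sum f {y \<in> cube_verts n. \<forall>k\<in>{1..n} - {i, j}. y k = x k} = cube_square_sum f i j x"
proof -
  \<comment> \<open>The corners must be distinct for the sum over the set to have four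
    terms.\<close>
  have "x \<noteq> cube_flip i (cube_flip j x)" "cube_flip i x \<noteq> cube_flip i (cube_flip j x)"
    using assms(4) by (metis cube_flip_eq_iff cube_flip_flip, metis cube_flip_flip cube_flip_neq_self(2))
  then show ?thesis
    unfolding cube_face_eq[OF assms] cube_square_sum_def using assms(4) by (simp add: add.assoc)
qed

lemma magic_faced_iff:
  "magic_faced n f \<longleftrightarrow> bij_betw f (cube_verts n) {1..2 ^ n} \<and>
    (\<exists>S. \<forall>x\<in>cube_verts n. \<forall>i\<in>{1..n}. \<forall>j\<in>{1..n}. i \<noteq> j \<longrightarrow> cube_square_sum f i j x = S)"
proof -
  have "(\<forall>F\<in>cube_faces n. sum f F = S) \<longleftrightarrow>
    (\<forall>x\<in>cube_verts n. \<forall>i\<in>{1..n}. \<forall>j\<in>{1..n}. i \<noteq> j \<longrightarrow>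
      sum f {y \<in> cube_verts n. \<forall>k\<in>{1..n} - {i, j}. y k = x k} = S)" for S
    unfolding cube_faces_def by blast
  then show ?thesis
    unfolding magic_faced_def by (simp only: sum_cube_face simp_thms cong: ball_cong imp_cong)
qed

lemma associative_iff:
  "associative n f \<longleftrightarrow> (\<exists>c. \<forall>x\<in>cube_verts n. f x + f (cube_anti n x) = c)"
  by (auto simp: associative_def cube_antipodal_iff)

section \<open>Centred labelings\<close>

text \<open>The values of the centred labels: from \<open>1 - 2^n\<close> to \<open>2^n - 1\<close>
  in steps of two. Doubling avoids a fractional centre.\<close>

definition cube_levels :: "nat \<Rightarrow> int set" where
  "cube_levels n = (\<lambda>v. 2 * int v + 1 - 2 ^ n) ` {..<2 ^ n}"

lemma finite_cube_levels [simp]: "finite (cube_levels n)"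
  by (simp add: cube_levels_def)

lemma card_cube_levels [simp]: "card (cube_levels n) = 2 ^ n"
  unfolding cube_levels_def by (subst card_image) (auto intro: inj_onI)

lemma cube_levels_uminus: "v \<in> cube_levels n \<Longrightarrow> - v \<in> cube_levels n"
proof -
  assume "v \<in> cube_levels n"
  then obtain w where w: "w < 2 ^ n" "v = 2 * int w + 1 - 2 ^ n"
    by (auto simp: cube_levels_def)
  \<comment> \<open>Negation reverses the index \<open>w\<close> within its range.\<close>
  then have "- v = 2 * int (2 ^ n - 1 - w) + 1 - 2 ^ n"
    by (simp add: of_nat_diff)
  moreover have "2 ^ n - 1 - w < 2 ^ n"
    by (simp add: less_imp_diff_less)
  ultimately show ?thesis
    unfolding cube_levels_def by blast
qed

lemma cube_levels_ge: "v \<in> cube_levels n \<Longrightarrow> 1 - 2 ^ n \<le> v"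
  by (auto simp: cube_levels_def)

lemma cube_levels_min: "1 - 2 ^ n \<in> cube_levels n"
  unfolding cube_levels_def by (rule image_eqI[of _ _ 0]) auto

definition centred_labeling :: "nat \<Rightarrow> ((nat \<Rightarrow> int) \<Rightarrow> int) \<Rightarrow> bool" where
  "centred_labeling n h \<longleftrightarrow> bij_betw h (cube_verts n) (cube_levels n) \<and>
     (\<forall>x\<in>cube_verts n. h (cube_anti n x) = - h x) \<and>
     (\<forall>x\<in>cube_verts n. \<forall>i\<in>{1..n}. \<forall>j\<in>{1..n}. i \<noteq> j \<longrightarrow> cube_square_sum h i j x = 0)"

lemma bij_betw_centre:
  "bij_betw (\<lambda>v. 2 * int v - 2 ^ n - 1) {1..2 ^ n} (cube_levels n)"
proof -
  have "cube_levels n = (\<lambda>v. 2 * int v - 2 ^ n - 1) ` {1..2 ^ n}"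
  proof -
    have *: "{1..2 ^ n} = Suc ` {..<2 ^ n}"
      by (simp add: lessThan_atLeast0 atLeastLessThanSuc_atLeastAtMost)
    show ?thesis
      unfolding cube_levels_def * image_image by (intro image_cong) auto
  qed
  then show ?thesis
    unfolding bij_betw_def by (auto intro: inj_onI)
qed

text \<open>Both magic constants are forced: summing the antipodal pairs over the cube fixes
  \<open>c\<close>, and comparing a face with its antipodal face fixes the face sum.\<close>

lemma centred_labeling_of_magic:
  assumes "magic_faced n g" "associative n g"
  shows "centred_labeling n (\<lambda>x. 2 * int (g x) - 2 ^ n - 1)"
proof -
  let ?V = "cube_verts n"
  from assms obtain S c where g: "bij_betw g ?V {1..2 ^ n}"
    and S: "\<And>x i j. x \<in> ?V \<Longrightarrow> i \<in> {1..n} \<Longrightarrow> j \<in> {1..n} \<Longrightarrow> i \<noteq> j \<Longrightarrow> cube_square_sum g i j x = S"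
    and c: "\<And>x. x \<in> ?V \<Longrightarrow> g x + g (cube_anti n x) = c"
    unfolding magic_faced_iff associative_iff by blast
  \<comment> \<open>The antipodal map permutes the vertices, so each label is counted twice.\<close>
  have "2 ^ n * c = (\<Sum>x\<in>?V. g x + g (cube_anti n x))"
    using c by simp
  also have "\<dots> = (\<Sum>x\<in>?V. g x) + (\<Sum>x\<in>?V. g x)"
    using sum.reindex_bij_betw[OF bij_betw_cube_anti, of g n] by (simp add: sum.distrib)
  also have "(\<Sum>x\<in>?V. g x) = \<Sum>{1..2 ^ n}"
    using sum.reindex_bij_betw[OF g, of "\<lambda>v. v"] by simp
  also have "\<Sum>{1..2 ^ n} + \<Sum>{1..2 ^ n} = 2 ^ n * (2 ^ n + 1 :: nat)"
    using double_gauss_sum_from_Suc_0[of "2 ^ n", where ?'a = nat] by simp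
  finally have "c = 2 ^ n + 1 \<or> 2 ^ n = (0 :: nat)"
    unfolding mult_cancel1 .
  then have c': "c = 2 ^ n + 1"
    by simp
  have anti: "int (g (cube_anti n x)) = 2 ^ n + 1 - int (g x)" if "x \<in> ?V" for x
  proof -
    have "int (g x + g (cube_anti n x)) = int (2 ^ n + 1)"
      using c[OF that] c' by simp
    then show ?thesis
      by simp
  qed
  have square: "int (cube_square_sum g i j x) = 2 * (2 ^ n + 1)"
    if "x \<in> ?V" "i \<in> {1..n}" "j \<in> {1..n}" "i \<noteq> j" for x i j
  proof -
    \<comment> \<open>The antipodal image of a face is again a face, with every label replaced by
      its complement to \<open>2^n + 1\<close>.\<close>
    have "int (cube_square_sum g i j (cube_anti n x)) = 4 * (2 ^ n + 1) - int (cube_square_sum g i j x)"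
      using that unfolding cube_square_sum_def
      by (simp add: cube_anti_flip[symmetric] anti)
    then show ?thesis
      using S[OF that] S[of "cube_anti n x" i j] that by simp
  qed
  show ?thesis
    unfolding centred_labeling_def
  proof (intro conjI ballI impI)
    show "bij_betw (\<lambda>x. 2 * int (g x) - 2 ^ n - 1) ?V (cube_levels n)"
      using bij_betw_trans[OF g bij_betw_centre] by (simp add: o_def)
  next
    fix x i j
    assume "x \<in> ?V" "i \<in> {1..n}" "j \<in> {1..n}" "i \<noteq> j"
    from square[OF this] show "cube_square_sum (\<lambda>x. 2 * int (g x) - 2 ^ n - 1) i j x = 0"
      by (simp add: cube_square_sum_def)
  qed (simp add: anti)
qed

lemma magic_of_centred_labeling:
  assumes "centred_labeling n h"
  obtains g where "magic_faced n g" "associative n g"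
    "\<And>x. x \<in> cube_verts n \<Longrightarrow> h x = 2 * int (g x) - 2 ^ n - 1"
proof -
  let ?V = "cube_verts n" and ?c = "\<lambda>v. 2 * int v - 2 ^ n - 1"
  have h: "bij_betw h ?V (cube_levels n)" "\<And>x. x \<in> ?V \<Longrightarrow> h (cube_anti n x) = - h x"
    "\<And>x i j. x \<in> ?V \<Longrightarrow> i \<in> {1..n} \<Longrightarrow> j \<in> {1..n} \<Longrightarrow> i \<noteq> j \<Longrightarrow> cube_square_sum h i j x = 0"
    using assms by (auto simp: centred_labeling_def)
  define g where "g x = inv_into {1..2 ^ n} ?c (h x)" for x
  have "g = inv_into {1..2 ^ n} ?c \<circ> h"
    by (simp add: g_def fun_eq_iff)
  then have bij: "bij_betw g ?V {1..2 ^ n}"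
    using bij_betw_trans[OF h(1) bij_betw_inv_into[OF bij_betw_centre]] by simp
  have hg: "h x = 2 * int (g x) - 2 ^ n - 1" if "x \<in> ?V" for x
  proof -
    have "h x \<in> cube_levels n"
      using h(1) that by (auto simp: bij_betw_def)
    then show ?thesis
      unfolding g_def using bij_betw_inv_into_right[OF bij_betw_centre, of "h x" n] by simp
  qed
  have "g x + g (cube_anti n x) = 2 ^ n + 1" if "x \<in> ?V" for x
  proof -
    have "int (g x + g (cube_anti n x)) = int (2 ^ n + 1)"
      using h(2)[OF that] hg[OF that] hg[of "cube_anti n x"] that by simp
    then show ?thesis
      by (simp only: of_nat_eq_iff)
  qed
  moreover have "cube_square_sum g i j x = 2 * (2 ^ n + 1)"
    if "x \<in> ?V" "i \<in> {1..n}" "j \<in> {1..n}" "i \<noteq> j" for x i j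
  proof -
    have "int (cube_square_sum g i j x) = int (2 * (2 ^ n + 1))"
      using h(3)[OF that] that by (simp add: cube_square_sum_def hg)
    then show ?thesis
      by (simp only: of_nat_eq_iff)
  qed
  ultimately show ?thesis
    using that[of g] bij hg by (auto simp: magic_faced_iff associative_iff)
qed

section \<open>Affine form of a labeling twisted by the parity sign\<close>

lemma affine_of_mixed_differences:
  fixes k :: "(nat \<Rightarrow> int) \<Rightarrow> int"
  assumes mixed: "\<And>x i j. x \<in> cube_verts n \<Longrightarrow> i \<in> {1..n} \<Longrightarrow> j \<in> {1..n} \<Longrightarrow> i \<noteq> j \<Longrightarrow>
      k (cube_flip i (cube_flip j x)) - k (cube_flip j x) = k (cube_flip i x) - k x"
    and "x \<in> cube_verts n"
  shows "k x = k (cube_zero n) + (\<Sum>i\<in>{1..n}. x i * (k (cube_flip i (cube_zero n)) - k (cube_zero n)))"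
proof -
  \<comment> \<open>Flipping another coordinate does not change the increment in direction
    \<open>i\<close>, so it equals the one at the origin. The premise \<open>x i = 0\<close> orients
    the increment and makes the case of flipping \<open>i\<close> itself vacuous.\<close>
  have diff: "x i = 0 \<longrightarrow> k (cube_flip i x) - k x = k (cube_flip i (cube_zero n)) - k (cube_zero n)"
    if "x \<in> cube_verts n" "i \<in> {1..n}" for x i
    using that
  proof (induction rule: cube_induct)
    case (flip x j)
    then have "cube_flip j x i = (if i = j then 1 else x i)"
      by (simp add: cube_flip_apply)
    then show ?case
      using mixed[of x i j] flip by (cases "i = j") simp_all
  qed simp
  show ?thesis
    using assms(2)
  proof (induction rule: cube_induct)
    case zero
    then show ?case
      by (simp add: cube_zero_def)
  next
    case (flip x i)
    then show ?case
      using diff[of x i] sum_cube_flip[OF flip(2), of x] by simp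
  qed
qed

lemma centred_labeling_affine:
  assumes "centred_labeling n h"
  obtains k0 \<alpha> where "\<And>x. x \<in> cube_verts n \<Longrightarrow> cube_sgn n x * h x = k0 + (\<Sum>i\<in>{1..n}. x i * \<alpha> i)"
proof -
  let ?k = "\<lambda>x. cube_sgn n x * h x"
  have mixed: "?k (cube_flip i (cube_flip j x)) - ?k (cube_flip j x) = ?k (cube_flip i x) - ?k x"
    if "x \<in> cube_verts n" "i \<in> {1..n}" "j \<in> {1..n}" "i \<noteq> j" for x i j
  proof -
    have "cube_square_sum h i j x = 0"
      using that assms by (auto simp: centred_labeling_def)
    \<comment> \<open>Signs alternate around the square, so a zero sum of \<open>h\<close> is a zero
      mixed difference of the signed function.\<close>
    then have "cube_sgn n x * cube_square_sum h i j x = 0"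
      by simp
    then show ?thesis
      using that by (simp add: cube_sgn_flip cube_square_sum_def algebra_simps)
  qed
  show ?thesis
  proof (rule that)
    fix x assume x: "x \<in> cube_verts n"
    show "?k x = ?k (cube_zero n) +
      (\<Sum>i\<in>{1..n}. x i * (?k (cube_flip i (cube_zero n)) - ?k (cube_zero n)))"
      by (rule affine_of_mixed_differences[where k = ?k], rule mixed, assumption+, rule x)
  qed
qed

text \<open>Antipodal invariance of the affine function kills all its coefficients, so all
  neighbours of the origin share one label; \<open>n > 1\<close> supplies two of them. For
  \<open>n = 1\<close> the labels 1 and 2 do form an associative labeling.\<close>

lemma no_odd_centred_labeling:
  assumes "odd n" "n > 1"
  shows "\<not> centred_labeling n h"
proof
  assume h: "centred_labeling n h"
  let ?z = "cube_zero n"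
  obtain k0 \<alpha> where k: "\<And>x. x \<in> cube_verts n \<Longrightarrow> cube_sgn n x * h x = k0 + (\<Sum>i\<in>{1..n}. x i * \<alpha> i)"
    using centred_labeling_affine[OF h] by metis
  have anti: "(\<Sum>i\<in>{1..n}. cube_anti n x i * \<alpha> i) = (\<Sum>i\<in>{1..n}. x i * \<alpha> i)"
    if "x \<in> cube_verts n" for x
  proof -
    \<comment> \<open>For odd \<open>n\<close> the sign and \<open>h\<close> are both negated by the
      antipodal map.\<close>
    have "cube_sgn n (cube_anti n x) * h (cube_anti n x) = cube_sgn n x * h x"
      using that h assms by (simp add: cube_sgn_anti centred_labeling_def)
    then show ?thesis
      using that k[of x] k[of "cube_anti n x"] by simp
  qed
  have \<alpha>: "\<alpha> i = 0" if i: "i \<in> {1..n}" for i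
  proof -
    have "cube_anti n ?z i = 1" "?z i = 0"
      using i by (simp_all add: cube_anti_def cube_zero_def)
    then show ?thesis
      \<comment> \<open>From the origin to its flip one side of the identity changes by -\<alpha> i
        and the other by \<alpha> i.\<close>
      using anti[of ?z] anti[of "cube_flip i ?z"] i
      by (simp only: cube_anti_flip sum_cube_flip cube_flip_in cube_zero_in) simp
  qed
  have "h (cube_flip i ?z) = - k0" if i: "i \<in> {1..n}" for i
  proof -
    have "cube_sgn n (cube_flip i ?z) = - 1"
      using i by (simp add: cube_sgn_flip) (simp add: cube_sgn_def cube_zero_def)
    then show ?thesis
      using k[of "cube_flip i ?z"] i \<alpha> by simp
  qed
  then have "h (cube_flip 1 ?z) = h (cube_flip 2 ?z)"
    using assms by simp
  moreover have "inj_on h (cube_verts n)"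
    using h by (auto simp: centred_labeling_def bij_betw_def)
  ultimately have "cube_flip 1 ?z = cube_flip 2 ?z"
    using assms by (auto dest!: inj_onD)
  then show False
    by simp
qed

text \<open>A collision between vertices of opposite sign would make them antipodal, but for even
  \<open>n\<close> antipodes have equal sign. The levels are closed under negation, and counting
  gives surjectivity.\<close>

lemma bij_betw_cube_sgn_times:
  assumes "even n" "bij_betw k (cube_verts n) (cube_levels n)"
    and anti: "\<And>x. x \<in> cube_verts n \<Longrightarrow> k (cube_anti n x) = - k x"
  shows "bij_betw (\<lambda>x. cube_sgn n x * k x) (cube_verts n) (cube_levels n)"
proof -
  let ?h = "\<lambda>x. cube_sgn n x * k x"
  have inj: "inj_on k (cube_verts n)" and im: "k ` cube_verts n = cube_levels n"
    using assms(2) by (auto simp: bij_betw_def)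
  have "inj_on ?h (cube_verts n)"
  proof (rule inj_onI)
    fix x y assume xy: "x \<in> cube_verts n" "y \<in> cube_verts n" and eq: "?h x = ?h y"
    show "x = y"
    proof (cases "cube_sgn n x = cube_sgn n y")
      case True
      then have "k x = k y"
        using eq cube_sgn_cases[OF xy(2)] by auto
      then show ?thesis
        using inj xy by (auto dest: inj_onD)
    next
      case False
      then have "k x = k (cube_anti n y)"
        using eq anti[OF xy(2)] cube_sgn_cases[OF xy(1)] cube_sgn_cases[OF xy(2)] by auto
      then have "x = cube_anti n y"
        using inj xy by (auto dest: inj_onD)
      then show ?thesis
        using False assms(1) by (simp add: cube_sgn_anti)
    qed
  qed
  moreover have "?h ` cube_verts n \<subseteq> cube_levels n"
  proof clarify
    fix x assume x: "x \<in> cube_verts n"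
    then have "k x \<in> cube_levels n"
      using im by blast
    then show "?h x \<in> cube_levels n"
      using cube_sgn_cases[OF x] cube_levels_uminus by auto
  qed
  ultimately show ?thesis
    unfolding bij_betw_def by (simp add: card_image card_subset_eq)
qed

section \<open>Subset sums and powers of two\<close>

text \<open>Binary expansion: the codes are distinct, lie below \<open>2^n\<close>, and are
  \<open>2^n\<close> in number.\<close>

lemma set_encode_Pow: "set_encode ` Pow {..<n} = {..<2 ^ n}"
proof (rule card_subset_eq)
  show "set_encode ` Pow {..<n} \<subseteq> {..<2 ^ n}"
  proof (rule image_subsetI)
    fix A assume "A \<in> Pow {..<n}"
    then have "set_encode A \<le> (\<Sum>i<n. 2 ^ i)"
      unfolding set_encode_def by (intro sum_mono2) auto
    also have "\<dots> < 2 ^ n"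
      by (induction n) auto
    finally show "set_encode A \<in> {..<2 ^ n}"
      by simp
  qed
  have "inj_on set_encode (Pow {..<n})"
    using inj_on_set_encode by (rule inj_on_subset) (auto intro: finite_subset)
  then show "card (set_encode ` Pow {..<n}) = card {..<2 ^ n :: nat}"
    by (simp add: card_image card_Pow)
qed auto

text \<open>If the powers below \<open>2^m\<close> occur as weights, then by uniqueness of subset sums every other weight is
  at least \<open>2^m\<close>, so \<open>2^m\<close> is itself a weight.\<close>

lemma powers_of_subset_sums:
  fixes c :: "'a \<Rightarrow> nat"
  assumes "finite I" and bij: "bij_betw (sum c) (Pow I) {..<2 ^ card I}"
  obtains q where "bij_betw q I {..<card I}" "\<And>i. i \<in> I \<Longrightarrow> c i = 2 ^ q i"
proof -
  have sum_inj: "A = B" if "A \<subseteq> I" "B \<subseteq> I" "sum c A = sum c B" for A B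
    using bij that by (auto simp: bij_betw_def inj_on_def)
  have fin: "finite A" if "A \<subseteq> I" for A
    using assms(1) that finite_subset by blast
  have pos: "c i > 0" if "i \<in> I" for i
  proof (rule ccontr)
    assume "\<not> c i > 0"
    then show False
      using sum_inj[of "{i}" "{}"] that by simp
  qed
  have "\<exists>i\<in>I. c i = 2 ^ m" if "m < card I" for m
    using that
  proof (induction m rule: less_induct)
    case (less m)
    then have "\<forall>j\<in>{..<m}. \<exists>i. i \<in> I \<and> c i = 2 ^ j"
      using dual_order.strict_trans by fastforce
    then obtain r where r: "\<And>j. j < m \<Longrightarrow> r j \<in> I" "\<And>j. j < m \<Longrightarrow> c (r j) = 2 ^ j"
      using bchoice[of "{..<m}" "\<lambda>j i. i \<in> I \<and> c i = 2 ^ j"] by auto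
    have r_inj: "inj_on r {..<m}"
      by (rule inj_onI) (metis lessThan_iff nat_power_eq_Suc_0_iff numeral_2_eq_2 one_less_numeral_iff power_inject_exp r(2) semiring_norm(76))
    have r_sum: "sum c (r ` B) = set_encode B" if "B \<subseteq> {..<m}" for B
    proof -
      have "sum c (r ` B) = (\<Sum>j\<in>B. c (r j))"
        using r_inj that by (subst sum.reindex) (auto intro: inj_on_subset)
      also have "\<dots> = set_encode B"
        unfolding set_encode_def using that r(2) by (intro sum.cong) auto
      finally show ?thesis .
    qed
    \<comment> \<open>The binary expansion of \<open>c i\<close> gives a set of the powers already
      found with the same sum; uniqueness of subset sums makes that set \<open>{i}\<close>.\<close>
    have small: "i \<in> r ` {..<m}" if "i \<in> I" "c i < 2 ^ m" for i
    proof -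
      from that set_encode_Pow[of m] obtain B where B: "B \<subseteq> {..<m}" "c i = set_encode B"
        by (metis PowD imageE lessThan_iff)
      then have "{i} = r ` B"
        using that r by (intro sum_inj) (auto simp: r_sum)
      then show ?thesis
        using B by blast
    qed
    have "2 ^ m \<in> sum c ` Pow I"
      using bij less.prems by (simp add: bij_betw_def)
    then obtain A where A: "A \<subseteq> I" "sum c A = 2 ^ m"
      by (auto simp: image_iff)
    show ?case
    \<comment> \<open>The powers already found sum to less than \<open>2^m\<close>, so
      \<open>A\<close> contains another weight. It is at least \<open>2^m\<close>, hence exactly
      \<open>2^m\<close>.\<close>
    proof (cases "A \<subseteq> r ` {..<m}")
      case True
      have "r ` {..<m} \<subseteq> I"
        using r by auto
      then have "sum c A \<le> sum c (r ` {..<m})"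
        using True fin by (intro sum_mono2) auto
      moreover have "set_encode {..<m} \<in> {..<2 ^ m}"
        unfolding set_encode_Pow[symmetric] by blast
      ultimately show ?thesis
        using A by (simp add: r_sum)
    next
      case False
      then obtain i where i: "i \<in> A" "\<not> c i < 2 ^ m"
        using small A by blast
      moreover have "sum c A = c i + sum c (A - {i})"
        using i A fin by (simp add: sum.remove)
      ultimately show ?thesis
        using A by auto
    qed
  qed
  then obtain r where r: "\<And>m. m < card I \<Longrightarrow> r m \<in> I" "\<And>m. m < card I \<Longrightarrow> c (r m) = 2 ^ m"
    by metis
  have inj: "inj_on r {..<card I}"
    by (rule inj_onI) (metis lessThan_iff one_less_numeral_iff power_inject_exp r(2) semiring_norm(76))
  have "r ` {..<card I} = I"
    using r inj assms(1) by (intro card_subset_eq) (auto simp: card_image)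
  then have "bij_betw r {..<card I} I"
    using inj by (simp add: bij_betw_def)
  then have "bij_betw (inv_into {..<card I} r) I {..<card I}"
    by (rule bij_betw_inv_into)
  moreover have "c i = 2 ^ inv_into {..<card I} r i" if "i \<in> I" for i
    using that \<open>r ` {..<card I} = I\<close> r(2)[of "inv_into {..<card I} r i"]
      f_inv_into_f[of i r "{..<card I}"] inv_into_into[of i r "{..<card I}"] by simp
  ultimately show ?thesis
    by (rule that)
qed

section \<open>The standard labeling and its uniqueness\<close>

text \<open>The number with binary digits \<open>x\<close>, lowest digit at coordinate 1, carried to
  the levels.\<close>

definition binary_labeling :: "nat \<Rightarrow> (nat \<Rightarrow> int) \<Rightarrow> int" where
  "binary_labeling n x = 1 - 2 ^ n + 2 * (\<Sum>i\<in>{1..n}. x i * 2 ^ (i - 1))"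

definition cube_indicator :: "nat \<Rightarrow> nat set \<Rightarrow> (nat \<Rightarrow> int)" where
  "cube_indicator n A = (\<lambda>i\<in>{1..n}. if i \<in> A then 1 else 0)"

lemma cube_indicator_in [simp]: "cube_indicator n A \<in> cube_verts n"
  by (simp add: cube_verts_iff cube_indicator_def)

lemma sum_cube_indicator:
  fixes c :: "nat \<Rightarrow> int"
  assumes "A \<subseteq> {1..n}"
  shows "(\<Sum>i\<in>{1..n}. cube_indicator n A i * c i) = sum c A"
proof -
  have "(\<Sum>i\<in>{1..n}. cube_indicator n A i * c i) = (\<Sum>i\<in>{1..n}. if i \<in> A then c i else 0)"
    by (intro sum.cong) (simp_all add: cube_indicator_def)
  also have "\<dots> = sum c ({1..n} \<inter> A)"
    by (simp add: sum.inter_restrict)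
  also have "{1..n} \<inter> A = A"
    using assms by blast
  finally show ?thesis .
qed

lemma inj_on_cube_indicator: "inj_on (cube_indicator n) (Pow {1..n})"
proof (rule inj_onI)
  fix A B assume *: "A \<in> Pow {1..n}" "B \<in> Pow {1..n}" "cube_indicator n A = cube_indicator n B"
  have "i \<in> A \<longleftrightarrow> i \<in> B" if "i \<in> {1..n}" for i
    using fun_cong[OF *(3), of i] that by (simp add: cube_indicator_def split: if_splits)
  then show "A = B"
    using *(1,2) by blast
qed

lemma sum_powers_of_two: "(\<Sum>i\<in>{1..n}. 2 ^ (i - 1)) = (2 ^ n - 1 :: int)"
  by (induction n) auto

lemma binary_labeling_anti: "binary_labeling n (cube_anti n x) = - binary_labeling n x"
proof -
  have "(\<Sum>i\<in>{1..n}. cube_anti n x i * 2 ^ (i - 1)) = (\<Sum>i\<in>{1..n}. 2 ^ (i - 1) - x i * 2 ^ (i - 1))"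
    by (intro sum.cong) (simp_all add: cube_anti_def algebra_simps)
  also have "\<dots> = 2 ^ n - 1 - (\<Sum>i\<in>{1..n}. x i * 2 ^ (i - 1))"
    unfolding sum_subtractf sum_powers_of_two ..
  finally show ?thesis
    unfolding binary_labeling_def by linarith
qed

lemma bij_betw_binary_labeling: "bij_betw (binary_labeling n) (cube_verts n) (cube_levels n)"
proof -
  have sub: "cube_levels n \<subseteq> binary_labeling n ` cube_verts n"
  proof
    fix v assume "v \<in> cube_levels n"
    then obtain w where w: "w < 2 ^ n" "v = 2 * int w + 1 - 2 ^ n"
      by (auto simp: cube_levels_def)
    then have "w \<in> set_encode ` Pow {..<n}"
      by (simp add: set_encode_Pow)
    then obtain A where A: "A \<subseteq> {..<n}" "w = set_encode A"
      by blast
    \<comment> \<open>\<open>set_encode\<close> counts bits from 0, coordinates from 1.\<close>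
    have "Suc ` A \<subseteq> {1..n}"
      using A by auto
    then have "(\<Sum>i\<in>{1..n}. cube_indicator n (Suc ` A) i * 2 ^ (i - 1)) = (\<Sum>i\<in>Suc ` A. 2 ^ (i - 1))"
      by (rule sum_cube_indicator)
    also have "\<dots> = int w"
      by (simp add: sum.reindex A(2) set_encode_def)
    finally have "binary_labeling n (cube_indicator n (Suc ` A)) = v"
      using w by (simp add: binary_labeling_def)
    then show "v \<in> binary_labeling n ` cube_verts n"
      using cube_indicator_in by blast
  qed
  have "card (binary_labeling n ` cube_verts n) \<le> card (cube_levels n)"
    using card_image_le[OF finite_cube_verts, of "binary_labeling n" n] by simp
  then have "binary_labeling n ` cube_verts n = cube_levels n"
    using card_seteq[OF finite_imageI[OF finite_cube_verts] sub] by blast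
  then show ?thesis
    unfolding bij_betw_def by (simp add: eq_card_imp_inj_on)
qed

lemma binary_labeling_flip:
  assumes "i \<in> {1..n}"
  shows "binary_labeling n (cube_flip i x) = binary_labeling n x + (1 - 2 * x i) * 2 ^ i"
proof -
  have "2 * (2::int) ^ (i - 1) = 2 ^ i"
    using assms by (simp flip: power_Suc)
  then show ?thesis
    unfolding binary_labeling_def sum_cube_flip[OF assms] by (simp add: algebra_simps)
qed

lemma centred_labeling_standard:
  assumes "even n"
  shows "centred_labeling n (\<lambda>x. cube_sgn n x * binary_labeling n x)"
  unfolding centred_labeling_def
proof (intro conjI ballI impI)
  show "bij_betw (\<lambda>x. cube_sgn n x * binary_labeling n x) (cube_verts n) (cube_levels n)"
    using assms bij_betw_binary_labeling binary_labeling_anti by (rule bij_betw_cube_sgn_times)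
next
  fix x assume "x \<in> cube_verts n"
  show "cube_sgn n (cube_anti n x) * binary_labeling n (cube_anti n x) =
      - (cube_sgn n x * binary_labeling n x)"
    using assms by (simp add: cube_sgn_anti binary_labeling_anti)
next
  fix x i j assume *: "i \<in> {1..n}" "j \<in> {1..n}" "i \<noteq> j"
  \<comment> \<open>The increment in direction \<open>i\<close> is thus the same on both sides of
    the square, and the alternating signs cancel it.\<close>
  then have "cube_flip j x i = x i"
    by (simp add: cube_flip_apply)
  then show "cube_square_sum (\<lambda>x. cube_sgn n x * binary_labeling n x) i j x = 0"
    unfolding cube_square_sum_def cube_sgn_flip[OF *(1)] cube_sgn_flip[OF *(2)]
      binary_labeling_flip[OF *(1)] binary_labeling_flip[OF *(2)]
    by (simp add: algebra_simps)
qed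

section \<open>Uniqueness in even dimension\<close>

text \<open>Nonnegative coefficients put the minimum at the origin, which determines \<open>m\<close>; the remaining levels
  are then given by the subset sums of \<open>\<beta>\<close>.\<close>

lemma affine_bij_imp_powers:
  fixes \<beta> :: "nat \<Rightarrow> int"
  assumes bij: "bij_betw (\<lambda>x. m + (\<Sum>i\<in>{1..n}. x i * \<beta> i)) (cube_verts n) (cube_levels n)"
    and nonneg: "\<And>i. i \<in> {1..n} \<Longrightarrow> \<beta> i \<ge> 0"
  obtains p where "p permutes {1..n}" "m = 1 - 2 ^ n" "\<And>i. i \<in> {1..n} \<Longrightarrow> \<beta> i = 2 ^ p i"
proof -
  let ?B = "\<lambda>x. m + (\<Sum>i\<in>{1..n}. x i * \<beta> i)"
  have B_in: "?B x \<in> cube_levels n" if "x \<in> cube_verts n" for x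
    using bij_betwE[OF bij] that by blast
  have B_ge: "m \<le> ?B x" if "x \<in> cube_verts n" for x
  proof -
    have "0 \<le> x i * \<beta> i" if i: "i \<in> {1..n}" for i
      using nonneg[OF i] \<open>x \<in> cube_verts n\<close> i by (auto elim: cube_verts_cases)
    then have "0 \<le> (\<Sum>i\<in>{1..n}. x i * \<beta> i)"
      by (rule sum_nonneg)
    then show ?thesis
      by simp
  qed
  have "?B (cube_zero n) = m"
    by (simp add: cube_zero_def)
  then have m_in: "m \<in> cube_levels n"
    using B_in[OF cube_zero_in] by simp
  have "1 - 2 ^ n \<in> ?B ` cube_verts n"
    using cube_levels_min[of n] unfolding bij_betw_imp_surj_on[OF bij] .
  then have "m \<le> 1 - 2 ^ n"
    using B_ge by auto
  then have m: "m = 1 - 2 ^ n"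
    using cube_levels_ge[OF m_in] by (rule antisym)
  have B_ind: "?B (cube_indicator n A) = m + sum \<beta> A" if "A \<subseteq> {1..n}" for A
    using sum_cube_indicator[OF that] by simp
  define c where "c i = nat (\<beta> i div 2)" for i
  have c: "\<beta> i = 2 * int (c i)" if i: "i \<in> {1..n}" for i
  proof -
    \<comment> \<open>The minimum \<open>m\<close> and this value are both levels, so their
      difference is even.\<close>
    have "m + \<beta> i \<in> cube_levels n"
      using B_in[OF cube_indicator_in, of "{i}"] B_ind[of "{i}"] i by simp
    then have "even (\<beta> i)"
      by (auto simp: m cube_levels_def)
    then show ?thesis
      using nonneg[OF i] by (simp add: c_def)
  qed
  have B_c: "?B (cube_indicator n A) = 2 * int (sum c A) + 1 - 2 ^ n" if A: "A \<subseteq> {1..n}" for A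
  proof -
    have "sum \<beta> A = (\<Sum>i\<in>A. 2 * int (c i))"
      using A c by (intro sum.cong) auto
    then show ?thesis
      using B_ind[OF A] m by (simp add: sum_distrib_left)
  qed
  have inj: "inj_on (sum c) (Pow {1..n})"
  proof (rule inj_onI)
    fix A A' assume A: "A \<in> Pow {1..n}" "A' \<in> Pow {1..n}" "sum c A = sum c A'"
    then have "?B (cube_indicator n A) = ?B (cube_indicator n A')"
      using B_c[of A] B_c[of A'] by simp
    then have "cube_indicator n A = cube_indicator n A'"
      by (rule inj_onD[OF bij_betw_imp_inj_on[OF bij]]) simp_all
    then show "A = A'"
      using inj_on_cube_indicator A by (auto dest: inj_onD)
  qed
  have "sum c ` Pow {1..n} = {..<2 ^ n}"
  proof (rule card_subset_eq)
    show "sum c ` Pow {1..n} \<subseteq> {..<2 ^ n}"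
    proof (rule image_subsetI)
      fix A assume "A \<in> Pow {1..n}"
      then have "2 * int (sum c A) + 1 - 2 ^ n \<in> cube_levels n"
        using B_c[of A] B_in[OF cube_indicator_in, of A] by simp
      then obtain w where "w < 2 ^ n" "2 * int (sum c A) + 1 - 2 ^ n = 2 * int w + 1 - 2 ^ n"
        unfolding cube_levels_def by blast
      then have "int (sum c A) = int w"
        by linarith
      then have "sum c A = w"
        by (simp only: of_nat_eq_iff)
      then show "sum c A \<in> {..<2 ^ n}"
        using \<open>w < 2 ^ n\<close> by simp
    qed
  qed (use inj in \<open>simp_all add: card_image card_Pow\<close>)
  then have "bij_betw (sum c) (Pow {1..n}) {..<2 ^ card {1..n}}"
    using inj by (simp add: bij_betw_def)
  then obtain q where q: "bij_betw q {1..n} {..<card {1..n}}" "\<And>i. i \<in> {1..n} \<Longrightarrow> c i = 2 ^ q i"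
    using powers_of_subset_sums[OF finite_atLeastAtMost] by metis
  \<comment> \<open>The exponents \<open>q i\<close> run from 0; the factor 2 between \<beta> and
    \<open>c\<close> raises them by one, into the range of coordinates.\<close>
  define p where "p i = (if i \<in> {1..n} then Suc (q i) else i)" for i
  have "bij_betw (Suc \<circ> q) {1..n} {1..n}"
  proof (rule bij_betw_trans[OF q(1)])
    show "bij_betw Suc {..<card {1..n}} {1..n}"
      by (simp add: bij_betw_def lessThan_atLeast0 atLeastLessThanSuc_atLeastAtMost)
  qed
  then have "bij_betw p {1..n} {1..n}"
    by (rule bij_betw_cong[THEN iffD1, rotated]) (simp add: p_def)
  then have "p permutes {1..n}"
    by (rule bij_imp_permutes) (auto simp: p_def)
  moreover have "\<beta> i = 2 ^ p i" if "i \<in> {1..n}" for i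
    using c[OF that] q(2)[OF that] that by (simp add: p_def)
  ultimately show ?thesis
    using that m by blast
qed

lemma binary_labeling_coord_perm:
  assumes "p permutes {1..n}"
  shows "binary_labeling n (coord_perm n p x) = 1 - 2 ^ n + (\<Sum>i\<in>{1..n}. x i * 2 ^ p i)"
proof -
  have "(\<Sum>i\<in>{1..n}. coord_perm n p x i * 2 ^ (i - 1)) =
      (\<Sum>i\<in>{1..n}. coord_perm n p x (p i) * 2 ^ (p i - 1))"
    using sum.permute[OF assms, of "\<lambda>i. coord_perm n p x i * 2 ^ (i - 1)"] by (simp add: o_def)
  also have "2 * \<dots> = (\<Sum>i\<in>{1..n}. x i * 2 ^ p i)"
    unfolding sum_distrib_left
  proof (intro sum.cong refl)
    fix i assume "i \<in> {1..n}"
    then have pi: "p i \<in> {1..n}"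
      using permutes_in_image[OF assms, of i] by blast
    then have "2 * (2::int) ^ (p i - 1) = 2 ^ p i"
      by (simp flip: power_Suc)
    then show "2 * (coord_perm n p x (p i) * 2 ^ (p i - 1)) = x i * 2 ^ p i"
      using pi permutes_inverses(2)[OF assms, of i] by (simp add: coord_perm_def)
  qed
  finally show ?thesis
    by (simp add: binary_labeling_def)
qed

lemma centred_labeling_unique:
  assumes "even n" and h: "centred_labeling n h"
  obtains a p where "p permutes {1..n}"
    "\<And>x. x \<in> cube_verts n \<Longrightarrow>
      h x = cube_sgn n (cube_affine n (a, p) x) * binary_labeling n (cube_affine n (a, p) x)"
proof -
  let ?V = "cube_verts n" and ?k = "\<lambda>x. cube_sgn n x * h x"
  obtain k0 \<alpha> where k: "\<And>x. x \<in> ?V \<Longrightarrow> ?k x = k0 + (\<Sum>i\<in>{1..n}. x i * \<alpha> i)"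
    using centred_labeling_affine[OF h] by metis
  have k_bij: "bij_betw ?k ?V (cube_levels n)"
    using h assms(1) by (intro bij_betw_cube_sgn_times) (auto simp: centred_labeling_def)
  \<comment> \<open>Reflecting exactly the coordinates with negative coefficient replaces \<alpha>
    by its absolute value; the resulting constants are collected in \<open>m\<close>.\<close>
  define \<kappa> where "\<kappa> = cube_indicator n {i \<in> {1..n}. \<alpha> i < 0}"
  have \<kappa>: "\<kappa> \<in> ?V"
    by (simp add: \<kappa>_def)
  define r where "r = cube_affine n (\<kappa>, id)"
  have r_apply: "r x i = (\<kappa> i + x i) mod 2" if "x \<in> ?V" "i \<in> {1..n}" for x i
    using cube_affine_apply[OF that, of \<kappa> id] by (simp add: r_def)
  have r_bij: "bij_betw r ?V ?V"
    using cube_affine_Bij[OF permutes_id, of n \<kappa>] by (simp add: r_def Bij_def)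
  define m where "m = k0 - (\<Sum>i\<in>{1..n}. \<kappa> i * \<bar>\<alpha> i\<bar>)"
  let ?B = "\<lambda>x. m + (\<Sum>i\<in>{1..n}. x i * \<bar>\<alpha> i\<bar>)"
  have k_r: "?k x = ?B (r x)" if x: "x \<in> ?V" for x
  proof -
    have "x i * \<alpha> i = r x i * \<bar>\<alpha> i\<bar> - \<kappa> i * \<bar>\<alpha> i\<bar>" if i: "i \<in> {1..n}" for i
    proof -
      have "\<kappa> i = (if \<alpha> i < 0 then 1 else 0)"
        using i by (simp add: \<kappa>_def cube_indicator_def)
      then show ?thesis
        using r_apply[OF x i] by (cases rule: cube_verts_cases[OF x i]) simp_all
    qed
    then have "(\<Sum>i\<in>{1..n}. x i * \<alpha> i) = (\<Sum>i\<in>{1..n}. r x i * \<bar>\<alpha> i\<bar> - \<kappa> i * \<bar>\<alpha> i\<bar>)"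
      by (intro sum.cong refl)
    then show ?thesis
      using k[OF x] by (simp add: m_def sum_subtractf)
  qed
  have "bij_betw (?B \<circ> r) ?V (cube_levels n)"
    using k_bij by (rule bij_betw_cong[THEN iffD1, rotated]) (simp add: k_r)
  then have "bij_betw ?B ?V (cube_levels n)"
    using bij_betw_comp_iff[OF r_bij] by blast
  then obtain p where p: "p permutes {1..n}" "m = 1 - 2 ^ n" "\<And>i. i \<in> {1..n} \<Longrightarrow> \<bar>\<alpha> i\<bar> = 2 ^ p i"
    by (rule affine_bij_imp_powers) auto
  \<comment> \<open>Reflecting first and permuting afterwards amounts to translating by the permuted
    reflection: P(\<kappa> + x) = P\<kappa> + Px.\<close>
  define a where "a = coord_perm n p \<kappa>"
  have a: "a \<in> ?V"
    using \<kappa> permutes_inv_in[OF p(1)] unfolding cube_verts_iff a_def coord_perm_def by simp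
  have perm: "coord_perm n p (r x) = cube_affine n (a, p) x" if x: "x \<in> ?V" for x
  proof -
    have "coord_perm n p (r x) i = cube_affine n (a, p) x i" if i: "i \<in> {1..n}" for i
      using cube_affine_apply[OF x i, of a p] r_apply[OF x permutes_inv_in[OF p(1) i]] i
      by (simp add: coord_perm_def a_def)
    then show ?thesis
      using x by (intro extensionalityI[of _ "{1..n}"]) (auto simp: coord_perm_def cube_affine_def)
  qed
  let ?h = "\<lambda>y. cube_sgn n y * binary_labeling n y"
  \<comment> \<open>The signs of \<open>x\<close> and of its image differ by the constant factor
    \<open>cube_sgn n a\<close>.\<close>
  have main: "h x = cube_sgn n a * ?h (cube_affine n (a, p) x)" if x: "x \<in> ?V" for x
  proof -
    have "?k x = binary_labeling n (cube_affine n (a, p) x)"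
      unfolding k_r[OF x] perm[OF x, symmetric] binary_labeling_coord_perm[OF p(1)] p(2)
      using p(3) by simp
    then have "h x = cube_sgn n x * binary_labeling n (cube_affine n (a, p) x)"
      using cube_sgn_square[OF x, of "h x"] by simp
    then show ?thesis
      using cube_sgn_square[OF a] by (simp add: cube_sgn_affine[OF a p(1) x] mult.assoc)
  qed
  show ?thesis
  proof (cases "cube_sgn n a = 1")
    case True
    then show ?thesis
      using that[OF p(1), of a] main by simp
  next
    case False
    \<comment> \<open>If that factor is -1, composing with the antipodal map negates the binary
      labeling and, for even \<open>n\<close>, keeps the parity sign.\<close>
    have "h x = ?h (cube_affine n (cube_anti n a, p) x)" if "x \<in> ?V" for x
      using main[OF that] False cube_sgn_cases[OF a] assms(1)
      by (simp add: cube_affine_anti[OF that] cube_sgn_anti binary_labeling_anti)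
    then show ?thesis
      using that[OF p(1)] by blast
  qed
qed

theorem theorem6:
  fixes n :: nat
  shows "(even n \<longrightarrow>
            (\<exists>f. magic_faced n f \<and> associative n f \<and>
               (\<forall>g. magic_faced n g \<and> associative n g \<longrightarrow>
                  (\<exists>\<phi>\<in>carrier (cube_aut n). \<forall>v\<in>cube_verts n. g v = f (\<phi> v)))))
       \<and> (odd n \<and> n > 1 \<longrightarrow> \<not> (\<exists>f. magic_faced n f \<and> associative n f))
       \<and> cube_aut n \<cong> C2n_semidirect_Sn n"
proof (intro conjI impI)
  assume n: "even n"
  obtain f where f: "magic_faced n f" "associative n f"
    "\<And>x. x \<in> cube_verts n \<Longrightarrow> cube_sgn n x * binary_labeling n x = 2 * int (f x) - 2 ^ n - 1"
    using magic_of_centred_labeling[OF centred_labeling_standard[OF n]] by metis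
  have "\<exists>\<phi>\<in>carrier (cube_aut n). \<forall>v\<in>cube_verts n. g v = f (\<phi> v)"
    if g: "magic_faced n g" "associative n g" for g
  proof -
    obtain a p where p: "p permutes {1..n}" and eq: "\<And>x. x \<in> cube_verts n \<Longrightarrow>
        2 * int (g x) - 2 ^ n - 1 =
          cube_sgn n (cube_affine n (a, p) x) * binary_labeling n (cube_affine n (a, p) x)"
      using centred_labeling_unique[OF n centred_labeling_of_magic[OF g]] by metis
    have "g x = f (cube_affine n (a, p) x)" if "x \<in> cube_verts n" for x
      \<comment> \<open>Both centred values come from the same injective rescaling, so the labels
        agree.\<close>
      using eq[OF that] f(3)[OF cube_affine_in[OF that]] by simp
    then show ?thesis
      using cube_affine_aut[OF p] by blast
  qed
  then show "\<exists>f. magic_faced n f \<and> associative n f \<and>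
      (\<forall>g. magic_faced n g \<and> associative n g \<longrightarrow>
        (\<exists>\<phi>\<in>carrier (cube_aut n). \<forall>v\<in>cube_verts n. g v = f (\<phi> v)))"
    using f by blast
next
  assume "odd n \<and> n > 1"
  then show "\<not> (\<exists>f. magic_faced n f \<and> associative n f)"
    using no_odd_centred_labeling centred_labeling_of_magic by blast
qed (rule iso_cube_aut)

end
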